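(* Let $A=(a_{i,j})$ be an $r\times r$ symmetrizable generalized Cartan matrix, $l\ge0$ and $P\in M_{l,r}(\mathbb{Z})$. Suppose that $\mathcal{A}_{\mathbb Z}(B_A\backslash\!\!\backslash P,\emptyset)$ is generated over $\mathbb{Z}[{\bf p}]$ by a subset $\mathcal{Z}$ of $\{u(i,m):(i,m)\in[1,r]\times\mathbb{Z}\}$. Then every frieze pattern $f$ associated to $A$ with coefficient matrix $P$ comes from a unique frieze $h:\mathcal{A}_{\mathbb Z}(B_A\backslash\!\!\backslash P,\emptyset)\to\mathbb{Z}$ via evaluation, i.e. $f(i,m)=h(u(i,m))$ for all $(i,m)\in[1,r]\times\mathbb{Z}$ and $f(p_j)=h(p_j)$ for all $j\in[1,l]$.
   Context: Notation: $[m,n]$ is the set of integers $k$ with $m\le k\le n$; $[a]_+=\max(a,0)$, applied entrywise to integer matrices; $M_{l,r}(\mathbb{Z})$ is the set of $l\times r$ integer matrices. For ${\bf a}=(a_1,\dots,a_n)$ and an integer column vector $L=(l_1,\dots,l_n)^T$, ${\bf a}^L=a_1^{l_1}\cdots a_n^{l_n}$. Symmetrizable generalized Cartan matrix: $a_{i,i}=2$, $a_{i,j}\in\mathbb{Z}_{\le0}$ for $i\ne j$, $a_{i,j}=0$ iff $a_{j,i}=0$, and $DA$ is symmetric for some diagonal $D$ with positive integer diagonal entries. $B_A$ is the $r\times r$ matrix with $(i,j)$ entry $-a_{i,j}$ if $i<j$, $0$ if $i=j$, $a_{i,j}$ if $i>j$. Cluster algebras of geometric type. A seed of extended rank $(r,l)$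 in a field $\mathbb{F}$ of rational functions over $\mathbb{Q}$ in $r+l$ variables is $\Sigma=({\bf u},{\bf p},\widetilde B)$, where ${\bf u}=(u_1,\ldots,u_r)$ and ${\bf p}=(p_1,\ldots,p_l)$ together freely generate $\mathbb{F}$ over $\mathbb{Q}$, and $\widetilde B=\binom{B}{P}=(b_{i,j})$, also written $(B\backslash\!\!\backslash P)$, is an $(r+l)\times r$ integer matrix whose top $r\times r$ part $B$ is skew-symmetrizable. With $B_k,P_k$ the $k$th columns of $B,P$, the mutation $\mu_k(\Sigma)=({\bf u}',{\bf p},\widetilde B')$, $k\in[1,r]$, has $u'_j=u_j$ for $j\ne k$, $u_ku_k'={\bf u}^{[B_k]_+}{\bf p}^{[P_k]_+}+{\bf u}^{[-B_k]_+}{\bf p}^{[-P_k]_+}$, and $b'_{i,j}=-b_{i,j}$ if $i=k$ or $j=k$, $b'_{i,j}=b_{i,j}+[b_{i,k}]_+[b_{k,j}]_+-[-b_{i,k}]_+[-b_{k,j}]_+$ otherwise. $\mathcal{S}(B_A\backslash\!\!\backslash P)$ is the collection of all seeds obtained by iterated mutation from an initial seed $\Sigma_{t_0}$ with extended mutation matrix $(B_A\backslash\!\!\backslash P)$. Entries of all the clusters ${\bf u}$ are cluster variables, entries of ${\bf p}$ are frozen variables; all of them are extended cluster variables. $\mathcal{A}_{\mathbb Z}(B_A\backslash\!\!\backslash P,\emptyset)\subset\mathbb{F}$ is the subring generated by all extended cluster variables. A frieze $h:\mathcal{A}_{\mathbb Z}(B_A\backslash\!\!\backslash P,\emptyset)\to\mathbb{Z}$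 is a ring homomorphism taking positive integer values on all extended cluster variables. Acyclic belt. Define seeds $\Sigma_{t(i,m)}=({\bf u}_{t(i,m)},{\bf p},(B_{t(i,m)}\backslash\!\!\backslash P_{t(i,m)}))$, $(i,m)\in[1,r]\times\mathbb{Z}$, by $\Sigma_{t(1,0)}=\Sigma_{t_0}$, $\Sigma_{t(i+1,m)}=\mu_i(\Sigma_{t(i,m)})$ for $i\in[1,r-1]$ and $\Sigma_{t(1,m+1)}=\mu_r(\Sigma_{t(r,m)})$, for all $m\in\mathbb{Z}$. Let $u(i,m)$ be the $i$th variable of ${\bf u}_{t(i,m)}$ and $p(i,m)\in\mathbb{Z}^l$ the $i$th column of $P_{t(i,m)}$. A frieze pattern associated to $A$ with coefficient matrix $P$ is a map $f:([1,r]\times\mathbb{Z})\cup\{p_1,\dots,p_l\}\to\mathbb{Z}_{>0}$ such that for all $(i,m)\in[1,r]\times\mathbb{Z}$, $$f(i,m)f(i,m+1)=f({\bf p})^{[p(i,m)]_+}+f({\bf p})^{[-p(i,m)]_+}\prod_{j=i+1}^rf(j,m)^{-a_{j,i}}\prod_{j=1}^{i-1}f(j,m+1)^{-a_{j,i}},$$ where $f({\bf p})=(f(p_1),\dots,f(p_l))$. *)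

theory Defs
  imports Complex_Main "HOL-Library.FuncSet" "HOL-Library.Poly_Mapping"
begin

text \<open>
  Rows, columns and variables are numbered from 1. Integer matrices, integer columns and tuples of
  field elements are functions on the natural numbers, of which only the entries in the index range
  at hand are meaningful. The ambient field of rational functions is the type
  \<^typ>\<open>'k::field_char_0\<close>, by the requirement in \<open>is_seed\<close> that the extended cluster
  freely generates all of it.
\<close>

definition pos_part :: "int \<Rightarrow> int" where
  "pos_part a = max a 0"

text \<open>The monomial \<open>a\<^sub>1^L\<^sub>1 \<cdots> a\<^sub>n^L\<^sub>n\<close>. It is only used for entrywise nonnegative \<open>L\<close>.\<close>

definition monomial_of :: "nat \<Rightarrow> (nat \<Rightarrow> 'a::comm_ring_1) \<Rightarrow> (nat \<Rightarrow> int) \<Rightarrow> 'a" where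
  "monomial_of n a L = (\<Prod>i\<in>{1..n}. a i ^ nat (L i))"


definition symmetrizable_gcm :: "nat \<Rightarrow> (nat \<Rightarrow> nat \<Rightarrow> int) \<Rightarrow> bool" where
  "symmetrizable_gcm r A \<longleftrightarrow>
     (\<forall>i\<in>{1..r}. A i i = 2) \<and>
     (\<forall>i\<in>{1..r}. \<forall>j\<in>{1..r}. i \<noteq> j \<longrightarrow> A i j \<le> 0) \<and>
     (\<forall>i\<in>{1..r}. \<forall>j\<in>{1..r}. A i j = 0 \<longleftrightarrow> A j i = 0) \<and>
     (\<exists>d :: nat \<Rightarrow> int. (\<forall>i\<in>{1..r}. d i > 0) \<and>
        (\<forall>i\<in>{1..r}. \<forall>j\<in>{1..r}. d i * A i j = d j * A j i))"

definition skew_symmetrizable :: "nat \<Rightarrow> (nat \<Rightarrow> nat \<Rightarrow> int) \<Rightarrow> bool" where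
  "skew_symmetrizable r B \<longleftrightarrow>
     (\<exists>d :: nat \<Rightarrow> int. (\<forall>i\<in>{1..r}. d i > 0) \<and>
        (\<forall>i\<in>{1..r}. \<forall>j\<in>{1..r}. d i * B i j = - (d j * B j i)))"

definition B_of :: "(nat \<Rightarrow> nat \<Rightarrow> int) \<Rightarrow> nat \<Rightarrow> nat \<Rightarrow> int" where
  "B_of A i j = (if i < j then - A i j else if i = j then 0 else A i j)"

text \<open>The matrix with \<open>B\<close> (of \<open>r\<close> rows) on top of \<open>P\<close>.\<close>

definition stack :: "nat \<Rightarrow> (nat \<Rightarrow> nat \<Rightarrow> int) \<Rightarrow> (nat \<Rightarrow> nat \<Rightarrow> int) \<Rightarrow> nat \<Rightarrow> nat \<Rightarrow> int" where
  "stack r B P i j = (if i \<le> r then B i j else P (i - r) j)"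


definition is_subring :: "'a::comm_ring_1 set \<Rightarrow> bool" where
  "is_subring R \<longleftrightarrow> 1 \<in> R \<and> (\<forall>x\<in>R. \<forall>y\<in>R. x - y \<in> R \<and> x * y \<in> R)"

definition subring_generated :: "'a::comm_ring_1 set \<Rightarrow> 'a set" where
  "subring_generated X = is_subring hull X"

definition is_subfield :: "'a::field set \<Rightarrow> bool" where
  "is_subfield K \<longleftrightarrow> is_subring K \<and> (\<forall>x\<in>K. inverse x \<in> K)"

text \<open>
  Polynomials over \<open>\<rat>\<close> in variables indexed by the natural numbers are finitely supported maps from
  exponent vectors to coefficients.
\<close>

definition eval_mpoly :: "(nat \<Rightarrow> 'k::field_char_0) \<Rightarrow> ((nat \<Rightarrow>\<^sub>0 nat) \<Rightarrow>\<^sub>0 rat) \<Rightarrow> 'k" where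
  "eval_mpoly x F =
     (\<Sum>e\<in>Poly_Mapping.keys F. of_rat (Poly_Mapping.lookup F e) *
        (\<Prod>i\<in>Poly_Mapping.keys e. x i ^ Poly_Mapping.lookup e i))"

definition alg_independent :: "nat set \<Rightarrow> (nat \<Rightarrow> 'k::field_char_0) \<Rightarrow> bool" where
  "alg_independent I x \<longleftrightarrow>
     (\<forall>F. (\<forall>e\<in>Poly_Mapping.keys F. Poly_Mapping.keys e \<subseteq> I) \<and> eval_mpoly x F = 0 \<longrightarrow> F = 0)"

text \<open>In characteristic 0 every subfield contains \<open>\<rat>\<close>, so \<open>\<rat>\<close> need not be adjoined.\<close>

definition freely_generates :: "nat set \<Rightarrow> (nat \<Rightarrow> 'k::field_char_0) \<Rightarrow> bool" where
  "freely_generates I x \<longleftrightarrow> alg_independent I x \<and> is_subfield hull (x ` I) = UNIV"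


text \<open>
  In a seed of extended rank \<open>(r, l)\<close>, \<open>exmat\<close> is the whole \<open>(r + l) \<times> r\<close> extended mutation
  matrix; its coefficient part consists of the rows \<open>r + 1, \<dots>, r + l\<close>.
\<close>

record 'k seed =
  cluster :: "nat \<Rightarrow> 'k"
  frozen :: "nat \<Rightarrow> 'k"
  exmat :: "nat \<Rightarrow> nat \<Rightarrow> int"

definition is_seed :: "nat \<Rightarrow> nat \<Rightarrow> 'k::field_char_0 seed \<Rightarrow> bool" where
  "is_seed r l S \<longleftrightarrow>
     freely_generates {1..r + l} (\<lambda>i. if i \<le> r then cluster S i else frozen S (i - r)) \<and>
     skew_symmetrizable r (exmat S)"

definition B_col :: "'k seed \<Rightarrow> nat \<Rightarrow> nat \<Rightarrow> int" where
  "B_col S k i = exmat S i k"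

definition P_col :: "nat \<Rightarrow> 'k seed \<Rightarrow> nat \<Rightarrow> nat \<Rightarrow> int" where
  "P_col r S k i = exmat S (r + i) k"

definition mutate_matrix :: "nat \<Rightarrow> (nat \<Rightarrow> nat \<Rightarrow> int) \<Rightarrow> nat \<Rightarrow> nat \<Rightarrow> int" where
  "mutate_matrix k b i j =
     (if i = k \<or> j = k then - b i j
      else b i j + pos_part (b i k) * pos_part (b k j) - pos_part (- b i k) * pos_part (- b k j))"

definition mutate :: "nat \<Rightarrow> nat \<Rightarrow> nat \<Rightarrow> 'k::field_char_0 seed \<Rightarrow> 'k seed" where
  "mutate r l k S =
     S\<lparr> cluster := (cluster S)(k :=
          (monomial_of r (cluster S) (\<lambda>i. pos_part (B_col S k i)) *
             monomial_of l (frozen S) (\<lambda>i. pos_part (P_col r S k i)) +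
           monomial_of r (cluster S) (\<lambda>i. pos_part (- B_col S k i)) *
             monomial_of l (frozen S) (\<lambda>i. pos_part (- P_col r S k i))) / cluster S k),
        exmat := mutate_matrix k (exmat S) \<rparr>"

inductive_set seeds :: "nat \<Rightarrow> nat \<Rightarrow> 'k::field_char_0 seed \<Rightarrow> 'k seed set"
  for r l :: nat and S0 :: "'k seed" where
  initial: "S0 \<in> seeds r l S0"
| mutation: "\<lbrakk>S \<in> seeds r l S0; k \<in> {1..r}\<rbrakk> \<Longrightarrow> mutate r l k S \<in> seeds r l S0"

definition cluster_variables :: "nat \<Rightarrow> nat \<Rightarrow> 'k::field_char_0 seed \<Rightarrow> 'k set" where
  "cluster_variables r l S0 = (\<Union>S\<in>seeds r l S0. cluster S ` {1..r})"

definition frozen_variables :: "nat \<Rightarrow> 'k seed \<Rightarrow> 'k set" where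
  "frozen_variables l S0 = frozen S0 ` {1..l}"

definition extended_cluster_variables :: "nat \<Rightarrow> nat \<Rightarrow> 'k::field_char_0 seed \<Rightarrow> 'k set" where
  "extended_cluster_variables r l S0 = cluster_variables r l S0 \<union> frozen_variables l S0"

definition cluster_algebra :: "nat \<Rightarrow> nat \<Rightarrow> 'k::field_char_0 seed \<Rightarrow> 'k set" where
  "cluster_algebra r l S0 = subring_generated (extended_cluster_variables r l S0)"

text \<open>
  A map defined on the cluster algebra only is a function that is \<^const>\<open>undefined\<close> outside of it, so
  that equality of friezes is equality of maps on the cluster algebra.
\<close>

definition is_frieze :: "nat \<Rightarrow> nat \<Rightarrow> 'k::field_char_0 seed \<Rightarrow> ('k \<Rightarrow> int) \<Rightarrow> bool" where
  "is_frieze r l S0 h \<longleftrightarrow>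
     h \<in> extensional (cluster_algebra r l S0) \<and>
     h 1 = 1 \<and>
     (\<forall>x\<in>cluster_algebra r l S0. \<forall>y\<in>cluster_algebra r l S0.
        h (x + y) = h x + h y \<and> h (x * y) = h x * h y) \<and>
     (\<forall>x\<in>extended_cluster_variables r l S0. h x > 0)"


text \<open>
  \<open>t i m\<close> is the seed at \<open>t(i, m)\<close>. Since mutation of seeds in a fixed direction is an involution,
  for a seed \<open>S0\<close> and \<open>r \<ge> 1\<close> the \<open>t i m\<close> with \<open>i \<in> {1..r}\<close> exist and are uniquely determined,
  also for \<open>m < 0\<close>.
\<close>

definition acyclic_belt ::
    "nat \<Rightarrow> nat \<Rightarrow> 'k::field_char_0 seed \<Rightarrow> (nat \<Rightarrow> int \<Rightarrow> 'k seed) \<Rightarrow> bool" where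
  "acyclic_belt r l S0 t \<longleftrightarrow>
     t 1 0 = S0 \<and>
     (\<forall>m. \<forall>i\<in>{1..<r}. t (i + 1) m = mutate r l i (t i m)) \<and>
     (\<forall>m. t 1 (m + 1) = mutate r l r (t r m))"

definition belt_var :: "(nat \<Rightarrow> int \<Rightarrow> 'k seed) \<Rightarrow> nat \<Rightarrow> int \<Rightarrow> 'k" where
  "belt_var t i m = cluster (t i m) i"

definition belt_coeff :: "nat \<Rightarrow> (nat \<Rightarrow> int \<Rightarrow> 'k seed) \<Rightarrow> nat \<Rightarrow> int \<Rightarrow> nat \<Rightarrow> int" where
  "belt_coeff r t i m = P_col r (t i m) i"

text \<open>
  A frieze pattern is given by its values \<open>f i m\<close> at \<open>(i, m)\<close> and \<open>fp j\<close> at \<open>p\<^sub>j\<close>; the columns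
  \<open>p(i, m)\<close> are passed as \<open>p i m\<close>.
\<close>

definition frieze_pattern ::
    "nat \<Rightarrow> nat \<Rightarrow> (nat \<Rightarrow> nat \<Rightarrow> int) \<Rightarrow> (nat \<Rightarrow> int \<Rightarrow> nat \<Rightarrow> int) \<Rightarrow>
     (nat \<Rightarrow> int \<Rightarrow> int) \<Rightarrow> (nat \<Rightarrow> int) \<Rightarrow> bool" where
  "frieze_pattern r l A p f fp \<longleftrightarrow>
     (\<forall>i\<in>{1..r}. \<forall>m. f i m > 0) \<and>
     (\<forall>j\<in>{1..l}. fp j > 0) \<and>
     (\<forall>i\<in>{1..r}. \<forall>m.
        f i m * f i (m + 1) =
          monomial_of l fp (\<lambda>j. pos_part (p i m j)) +
          monomial_of l fp (\<lambda>j. pos_part (- p i m j)) *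
            (\<Prod>j\<in>{i + 1..r}. f j m ^ nat (- A j i)) *
            (\<Prod>j\<in>{1..<i}. f j (m + 1) ^ nat (- A j i)))"

end

(*
  The initial cluster together with the frozen variables is algebraically independent, so sending it
  to the (positive integer) values f(i,0), f(p_j) extends to a ring homomorphism from the local ring
  of all rational functions F/G with G nonvanishing at these values into the rationals. As the
  exchange relations are subtraction-free, every cluster variable lies in this local ring and has a
  positive value; this makes the Laurent phenomenon superfluous. Along the acyclic belt the
  mutation matrix just runs through the reorderings of B_A, the exchange relations are those of a
  frieze pattern, and so u(i,m) has the value f(i,m). Since the frozen variables and Z generate the
  cluster algebra, all values on it are integers.
*)
theory Submission imports Defs begin

section \<open>Evaluation of polynomials\<close>

definition mpolys_in :: "nat set \<Rightarrow> ((nat \<Rightarrow>\<^sub>0 nat) \<Rightarrow>\<^sub>0 rat) set" where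
  "mpolys_in I = {F. \<forall>e\<in>Poly_Mapping.keys F. Poly_Mapping.keys e \<subseteq> I}"

lemma mpolys_in_add: "F \<in> mpolys_in I \<Longrightarrow> G \<in> mpolys_in I \<Longrightarrow> F + G \<in> mpolys_in I"
  unfolding mpolys_in_def using Poly_Mapping.keys_add[of F G] by blast

lemma mpolys_in_diff: "F \<in> mpolys_in I \<Longrightarrow> G \<in> mpolys_in I \<Longrightarrow> F - G \<in> mpolys_in I"
  unfolding mpolys_in_def using keys_diff[of F G] by blast

lemma mpolys_in_mult:
  assumes "F \<in> mpolys_in I" "G \<in> mpolys_in I"
  shows "F * G \<in> mpolys_in I"
proof -
  have "Poly_Mapping.keys e \<subseteq> I" if e: "e \<in> Poly_Mapping.keys (F * G)" for e
  proof -
    obtain a b where "e = a + b" "a \<in> Poly_Mapping.keys F" "b \<in> Poly_Mapping.keys G"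
      using e keys_mult[of F G] by blast
    then show ?thesis
      using assms Poly_Mapping.keys_add[of a b] unfolding mpolys_in_def by blast
  qed
  then show ?thesis
    by (simp add: mpolys_in_def)
qed

lemma mpolys_in_one: "1 \<in> mpolys_in I"
  by (simp add: mpolys_in_def)

lemma mpolys_in_var: "i \<in> I \<Longrightarrow> Poly_Mapping.single (Poly_Mapping.single i (Suc 0)) 1 \<in> mpolys_in I"
  by (simp add: mpolys_in_def)

lemma eval_mpoly_zero [simp]: "eval_mpoly x 0 = 0"
  by (simp add: eval_mpoly_def)

lemma eval_mpoly_add: "eval_mpoly x (F + G) = eval_mpoly x F + eval_mpoly x G"
  unfolding eval_mpoly_def
  by (rule setsum_keys_plus_distrib) (simp_all add: of_rat_add distrib_right)

lemma eval_mpoly_diff: "eval_mpoly x (F - G) = eval_mpoly x F - eval_mpoly x G"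
  using eval_mpoly_add[of x "F - G" G] by simp

lemma eval_mpoly_single:
  "eval_mpoly x (Poly_Mapping.single e c) =
     of_rat c * (\<Prod>i\<in>Poly_Mapping.keys e. x i ^ Poly_Mapping.lookup e i)"
  by (simp add: eval_mpoly_def)

lemma eval_mpoly_one [simp]: "eval_mpoly x 1 = 1"
  by (simp add: eval_mpoly_def lookup_one)

lemma eval_mpoly_var:
  "eval_mpoly x (Poly_Mapping.single (Poly_Mapping.single i (Suc 0)) 1) = x i"
  by (simp add: eval_mpoly_single)

lemma prod_power_lookup_add:
  fixes x :: "nat \<Rightarrow> 'a::comm_monoid_mult"
  shows "(\<Prod>i\<in>Poly_Mapping.keys (d + e). x i ^ Poly_Mapping.lookup (d + e) i) =
    (\<Prod>i\<in>Poly_Mapping.keys d. x i ^ Poly_Mapping.lookup d i) *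
    (\<Prod>i\<in>Poly_Mapping.keys e. x i ^ Poly_Mapping.lookup e i)"
proof -
  let ?U = "Poly_Mapping.keys d \<union> Poly_Mapping.keys e"
  \<comment> \<open>Enlarging the index set to the union of the supports only adds factors with
    exponent 0, so all three products can be compared over one set.\<close>
  have ext: "(\<Prod>i\<in>Poly_Mapping.keys c. x i ^ Poly_Mapping.lookup c i) =
      (\<Prod>i\<in>?U. x i ^ Poly_Mapping.lookup c i)" if "Poly_Mapping.keys c \<subseteq> ?U" for c
    using that by (intro prod.mono_neutral_left) (auto simp: in_keys_iff)
  show ?thesis
    unfolding ext[OF Poly_Mapping.keys_add] ext[OF Un_upper1] ext[OF Un_upper2]
    by (simp add: lookup_add power_add prod.distrib)
qed

text \<open>Splits a polynomial into terms in a form suited to additive maps: the key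
  \<open>a\<close> may already occur in \<open>F\<close>.\<close>

lemma poly_mapping_add_induct [case_names zero single_add]:
  assumes "P 0" and "\<And>a b F. P F \<Longrightarrow> P (Poly_Mapping.single a b + F)"
  shows "P F"
proof (induction F rule: Poly_Mapping.update_induct)
  case const
  show ?case by (rule assms(1))
next
  case (update F a b)
  have "Poly_Mapping.update a b F = Poly_Mapping.single a b + F"
    using update.hyps(1)
    by (intro poly_mapping_eqI)
       (auto simp: lookup_update lookup_add lookup_single when_def in_keys_iff)
  then show ?case
    using assms(2)[OF update.IH] by simp
qed

text \<open>By additivity in each factor it suffices to multiply two single terms, where
  coefficients multiply and exponent vectors add.\<close>

lemma eval_mpoly_mult: "eval_mpoly x (F * G) = eval_mpoly x F * eval_mpoly x G"
proof (induction F rule: poly_mapping_add_induct)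
  case zero
  show ?case by simp
next
  case (single_add a b F)
  have "eval_mpoly x (Poly_Mapping.single a b * G) =
      eval_mpoly x (Poly_Mapping.single a b) * eval_mpoly x G"
  proof (induction G rule: poly_mapping_add_induct)
    case zero
    show ?case by simp
  next
    case (single_add c d G)
    then show ?case
      by (simp add: distrib_left eval_mpoly_add mult_single)
         (simp add: eval_mpoly_single prod_power_lookup_add of_rat_mult algebra_simps)
  qed
  with single_add show ?case
    by (simp add: distrib_right eval_mpoly_add)
qed

text \<open>Vanishing at \<open>x\<close> would make \<open>F\<close> the zero polynomial, which
  also vanishes at \<open>v\<close>. Thus nonvanishing moves from the concrete point
  \<open>v\<close> to the generic point \<open>x\<close>.\<close>

lemma alg_independent_eval_nonzero:
  assumes "alg_independent I x" "F \<in> mpolys_in I" "eval_mpoly v F \<noteq> 0"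
  shows "eval_mpoly x F \<noteq> 0"
  using assms unfolding alg_independent_def mpolys_in_def by fastforce

section \<open>Specialization of rational functions\<close>

text \<open>
  As a relation, \<open>specializes I x v\<close> is the graph of the homomorphism \<open>x i \<mapsto> v i\<close> on the local ring of
  those rational functions in \<open>x\<close> whose denominator does not vanish at \<open>v\<close>.
\<close>

definition specializes ::
    "nat set \<Rightarrow> (nat \<Rightarrow> 'a::field_char_0) \<Rightarrow> (nat \<Rightarrow> 'b::field_char_0) \<Rightarrow> 'a \<Rightarrow> 'b \<Rightarrow> bool" where
  "specializes I x v a q \<longleftrightarrow>
     (\<exists>F\<in>mpolys_in I. \<exists>G\<in>mpolys_in I. eval_mpoly v G \<noteq> 0 \<and>
        a * eval_mpoly x G = eval_mpoly x F \<and> q * eval_mpoly v G = eval_mpoly v F)"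

lemma specializes_var: "i \<in> I \<Longrightarrow> specializes I x v (x i) (v i)"
  unfolding specializes_def
  by (rule bexI[of _ "Poly_Mapping.single (Poly_Mapping.single i (Suc 0)) 1"], rule bexI[of _ 1])
     (simp_all add: mpolys_in_one mpolys_in_var eval_mpoly_var del: single_one)

lemma specializes_one: "specializes I x v 1 1"
  unfolding specializes_def
  by (rule bexI[of _ 1], rule bexI[of _ 1]) (simp_all add: mpolys_in_one)

lemma specializes_add:
  assumes "specializes I x v a q" "specializes I x v b s"
  shows "specializes I x v (a + b) (q + s)"
proof -
  obtain F G where 1: "F \<in> mpolys_in I" "G \<in> mpolys_in I" "eval_mpoly v G \<noteq> 0"
      "a * eval_mpoly x G = eval_mpoly x F" "q * eval_mpoly v G = eval_mpoly v F"
    using assms(1) unfolding specializes_def by blast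
  obtain F' G' where 2: "F' \<in> mpolys_in I" "G' \<in> mpolys_in I" "eval_mpoly v G' \<noteq> 0"
      "b * eval_mpoly x G' = eval_mpoly x F'" "s * eval_mpoly v G' = eval_mpoly v F'"
    using assms(2) unfolding specializes_def by blast
  show ?thesis
    unfolding specializes_def
    by (rule bexI[of _ "F * G' + F' * G"], rule bexI[of _ "G * G'"])
       (use 1 2 in \<open>auto simp: mpolys_in_add mpolys_in_mult eval_mpoly_mult eval_mpoly_add
          algebra_simps simp flip: 1(4,5) 2(4,5)\<close>)
qed

lemma specializes_diff:
  assumes "specializes I x v a q" "specializes I x v b s"
  shows "specializes I x v (a - b) (q - s)"
proof -
  obtain F G where 1: "F \<in> mpolys_in I" "G \<in> mpolys_in I" "eval_mpoly v G \<noteq> 0"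
      "a * eval_mpoly x G = eval_mpoly x F" "q * eval_mpoly v G = eval_mpoly v F"
    using assms(1) unfolding specializes_def by blast
  obtain F' G' where 2: "F' \<in> mpolys_in I" "G' \<in> mpolys_in I" "eval_mpoly v G' \<noteq> 0"
      "b * eval_mpoly x G' = eval_mpoly x F'" "s * eval_mpoly v G' = eval_mpoly v F'"
    using assms(2) unfolding specializes_def by blast
  show ?thesis
    unfolding specializes_def
    by (rule bexI[of _ "F * G' - F' * G"], rule bexI[of _ "G * G'"])
       (use 1 2 in \<open>auto simp: mpolys_in_diff mpolys_in_mult eval_mpoly_mult eval_mpoly_diff
          algebra_simps simp flip: 1(4,5) 2(4,5)\<close>)
qed

lemma specializes_mult:
  assumes "specializes I x v a q" "specializes I x v b s"
  shows "specializes I x v (a * b) (q * s)"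
proof -
  obtain F G where 1: "F \<in> mpolys_in I" "G \<in> mpolys_in I" "eval_mpoly v G \<noteq> 0"
      "a * eval_mpoly x G = eval_mpoly x F" "q * eval_mpoly v G = eval_mpoly v F"
    using assms(1) unfolding specializes_def by blast
  obtain F' G' where 2: "F' \<in> mpolys_in I" "G' \<in> mpolys_in I" "eval_mpoly v G' \<noteq> 0"
      "b * eval_mpoly x G' = eval_mpoly x F'" "s * eval_mpoly v G' = eval_mpoly v F'"
    using assms(2) unfolding specializes_def by blast
  show ?thesis
    unfolding specializes_def
    by (rule bexI[of _ "F * F'"], rule bexI[of _ "G * G'"])
       (use 1 2 in \<open>auto simp: mpolys_in_mult eval_mpoly_mult algebra_simps
          simp flip: 1(4,5) 2(4,5)\<close>)
qed

text \<open>The numerator \<open>F'\<close> of \<open>b\<close> becomes part of the new denominator.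
  It is nonzero at \<open>v\<close> because \<open>s\<close> is nonzero, hence by independence
  nonzero at \<open>x\<close>, which also excludes \<open>b = 0\<close>.\<close>

lemma specializes_divide:
  assumes "alg_independent I x" "specializes I x v a q" "specializes I x v b s" "s \<noteq> 0"
  shows "specializes I x v (a / b) (q / s)"
proof -
  obtain F G where 1: "F \<in> mpolys_in I" "G \<in> mpolys_in I" "eval_mpoly v G \<noteq> 0"
      "a * eval_mpoly x G = eval_mpoly x F" "q * eval_mpoly v G = eval_mpoly v F"
    using assms(2) unfolding specializes_def by blast
  obtain F' G' where 2: "F' \<in> mpolys_in I" "G' \<in> mpolys_in I" "eval_mpoly v G' \<noteq> 0"
      "b * eval_mpoly x G' = eval_mpoly x F'" "s * eval_mpoly v G' = eval_mpoly v F'"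
    using assms(3) unfolding specializes_def by blast
  have v: "eval_mpoly v F' \<noteq> 0"
    using 2(3,5) assms(4) by (metis mult_eq_0_iff)
  then have "b \<noteq> 0"
    using alg_independent_eval_nonzero[OF assms(1) 2(1)] 2(4) by (metis mult_zero_left)
  show ?thesis
    unfolding specializes_def
    by (rule bexI[of _ "F * G'"], rule bexI[of _ "G * F'"])
       (use 1 2 v assms(4) \<open>b \<noteq> 0\<close> in \<open>auto simp: mpolys_in_mult eval_mpoly_mult field_simps
          simp flip: 1(4,5) 2(4,5)\<close>)
qed

text \<open>A fraction representing 0 has a numerator vanishing at \<open>x\<close>, hence by
  independence at \<open>v\<close>. Contrapositively, an element with a nonzero value is nonzero,
  which later justifies undoing mutations.\<close>

lemma specializes_zero_imp:
  assumes "alg_independent I x" "specializes I x v 0 q"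
  shows "q = 0"
proof -
  obtain F G where 1: "F \<in> mpolys_in I" "eval_mpoly v G \<noteq> 0"
      "eval_mpoly x F = 0" "q * eval_mpoly v G = eval_mpoly v F"
    using assms(2) unfolding specializes_def by fastforce
  have "eval_mpoly v F = 0"
    using alg_independent_eval_nonzero[OF assms(1) 1(1)] 1(3) by blast
  then show ?thesis
    using 1 by simp
qed

lemma specializes_unique:
  assumes "alg_independent I x" "specializes I x v a q" "specializes I x v a s"
  shows "q = s"
  using specializes_zero_imp[OF assms(1), of v "q - s"] specializes_diff[OF assms(2,3)] by simp

lemma specializes_power: "specializes I x v a q \<Longrightarrow> specializes I x v (a ^ n) (q ^ n)"
  by (induction n) (simp_all add: specializes_one specializes_mult)

lemma specializes_prod:
  "(\<And>j. j \<in> J \<Longrightarrow> specializes I x v (a j) (q j)) \<Longrightarrow> specializes I x v (prod a J) (prod q J)"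
  by (induction J rule: infinite_finite_induct) (simp_all add: specializes_one specializes_mult)

lemma specializes_monomial_of:
  "(\<And>j. j \<in> {1..n} \<Longrightarrow> specializes I x v (a j) (q j)) \<Longrightarrow>
    specializes I x v (monomial_of n a L) (monomial_of n q L)"
  unfolding monomial_of_def by (intro specializes_prod specializes_power) auto

lemma monomial_of_pos:
  fixes a :: "nat \<Rightarrow> 'a::linordered_field"
  assumes "\<And>j. j \<in> {1..n} \<Longrightarrow> a j > 0"
  shows "monomial_of n a L > 0"
  unfolding monomial_of_def using assms by (intro prod_pos) simp

lemma of_int_monomial_of:
  "of_int (monomial_of n a L) = monomial_of n (\<lambda>j. of_int (a j)) L"
  by (simp add: monomial_of_def)

section \<open>Mutation matrices along the acyclic belt\<close>

lemma mutate_matrix_involutive: "mutate_matrix k (mutate_matrix k b) = b"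
  by (intro ext) (auto simp: mutate_matrix_def)

text \<open>
  Up to row and column \<open>r\<close>, the mutation matrix at \<open>t(k,m)\<close>: it is \<^const>\<open>B_of\<close> for the order
  \<open>k, k + 1, \<dots>, r, 1, \<dots>, k - 1\<close> of the indices. The case \<open>k = r + 1\<close> is the case \<open>k = 1\<close>.
\<close>

definition belt_matrix :: "(nat \<Rightarrow> nat \<Rightarrow> int) \<Rightarrow> nat \<Rightarrow> nat \<Rightarrow> nat \<Rightarrow> int" where
  "belt_matrix A k i j = (if (i < k) = (j < k) then B_of A i j else - B_of A i j)"

text \<open>In the order starting with \<open>k\<close>, column \<open>k\<close> is nonpositive and
  row \<open>k\<close> is nonnegative, so both correction terms of the mutation vanish. Only the
  signs in row and column \<open>k\<close> change, which moves \<open>k\<close> to the end of the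
  order.\<close>

lemma mutate_belt_matrix:
  assumes "symmetrizable_gcm r A" "k \<in> {1..r}" "i \<in> {1..r}" "j \<in> {1..r}"
  shows "mutate_matrix k (belt_matrix A k) i j = belt_matrix A (Suc k) i j"
proof -
  have neg: "A i j \<le> 0" if "i \<in> {1..r}" "j \<in> {1..r}" "i \<noteq> j" for i j
    using assms(1) that by (simp add: symmetrizable_gcm_def)
  show ?thesis
    using assms(2-4) neg[of i k] neg[of k j]
    by (auto simp: mutate_matrix_def belt_matrix_def B_of_def pos_part_def)
qed

lemma mutate_matrix_cong:
  assumes "\<And>i j. i \<in> R \<Longrightarrow> j \<in> R \<Longrightarrow> b i j = c i j" "k \<in> R" "i \<in> R" "j \<in> R"
  shows "mutate_matrix k b i j = mutate_matrix k c i j"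
  using assms by (simp add: mutate_matrix_def)

text \<open>An equivalence, because the belt is followed backwards for negative \<open>m\<close>.
  The backward direction mutates both sides at \<open>k\<close> once more.\<close>

lemma belt_matrix_step:
  assumes gcm: "symmetrizable_gcm r A" and k: "k \<in> {1..r}"
  shows "(\<forall>i\<in>{1..r}. \<forall>j\<in>{1..r}. b i j = belt_matrix A k i j) \<longleftrightarrow>
    (\<forall>i\<in>{1..r}. \<forall>j\<in>{1..r}. mutate_matrix k b i j = belt_matrix A (Suc k) i j)"
    (is "?L \<longleftrightarrow> ?R")
proof
  assume ?L
  show ?R
  proof (intro ballI)
    fix i j assume ij: "i \<in> {1..r}" "j \<in> {1..r}"
    have "mutate_matrix k b i j = mutate_matrix k (belt_matrix A k) i j"
      by (rule mutate_matrix_cong[OF _ k ij]) (use \<open>?L\<close> in blast)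
    then show "mutate_matrix k b i j = belt_matrix A (Suc k) i j"
      using mutate_belt_matrix[OF gcm k ij] by simp
  qed
next
  assume ?R
  show ?L
  proof (intro ballI)
    fix i j assume ij: "i \<in> {1..r}" "j \<in> {1..r}"
    have "mutate_matrix k (mutate_matrix k b) i j =
        mutate_matrix k (mutate_matrix k (belt_matrix A k)) i j"
      by (rule mutate_matrix_cong[OF _ k ij])
         (use \<open>?R\<close> mutate_belt_matrix[OF gcm k] in simp)
    then show "b i j = belt_matrix A k i j"
      by (simp add: mutate_matrix_involutive)
  qed
qed

section \<open>Values of cluster variables\<close>

lemma frozen_mutate [simp]: "frozen (mutate r l k S) = frozen S"
  by (simp add: mutate_def)

lemma exmat_mutate [simp]: "exmat (mutate r l k S) = mutate_matrix k (exmat S)"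
  by (simp add: mutate_def)

lemma mutate_involutive:
  assumes "exmat S k k = 0" and nz: "cluster S k \<noteq> 0" "cluster (mutate r l k S) k \<noteq> 0"
  shows "mutate r l k (mutate r l k S) = S"
proof -
  have B: "B_col (mutate r l k S) k i = - B_col S k i" for i
    by (simp add: B_col_def mutate_matrix_def)
  have P: "P_col r (mutate r l k S) k i = - P_col r S k i" for i
    by (simp add: P_col_def mutate_matrix_def)
  \<comment> \<open>The signs \<open>s = 1\<close> and \<open>s = -1\<close> give the two exchange
    monomials. The exponent at \<open>k\<close> is 0 by the first assumption, so replacing the
    variable \<open>k\<close> does not affect them.\<close>
  have mono: "monomial_of r (cluster (mutate r l k S)) (\<lambda>i. pos_part (s * B_col S k i)) =
      monomial_of r (cluster S) (\<lambda>i. pos_part (s * B_col S k i))" for s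
    unfolding monomial_of_def
    by (rule prod.cong) (use assms(1) in \<open>auto simp: mutate_def B_col_def pos_part_def\<close>)
  define N where "N = monomial_of r (cluster S) (\<lambda>i. pos_part (B_col S k i)) *
      monomial_of l (frozen S) (\<lambda>i. pos_part (P_col r S k i)) +
    monomial_of r (cluster S) (\<lambda>i. pos_part (- B_col S k i)) *
      monomial_of l (frozen S) (\<lambda>i. pos_part (- P_col r S k i))"
  have k: "cluster (mutate r l k S) k = N / cluster S k"
    by (simp add: mutate_def N_def)
  \<comment> \<open>Negating column \<open>k\<close> swaps the two summands of the exchange
    numerator, so both mutations share the same \<open>N\<close>.\<close>
  have "cluster (mutate r l k (mutate r l k S)) =
      (cluster (mutate r l k S))(k := N / cluster (mutate r l k S) k)"
    unfolding mutate_def[of r l k "mutate r l k S"] B P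
    using mono[of 1] mono[of "-1"] by (simp add: N_def add.commute)
  also have "\<dots> = cluster S"
    using nz unfolding k by (intro ext) (auto simp: mutate_def)
  finally show ?thesis
    by (simp add: seed.equality mutate_matrix_involutive)
qed

section \<open>Positivity of the values in all seeds\<close>

lemma frozen_seeds: "S \<in> seeds r l S0 \<Longrightarrow> frozen S = frozen S0"
  by (induction rule: seeds.induct) simp_all

lemma cluster_mutate_specializes_pos:
  fixes v :: "nat \<Rightarrow> 'b::linordered_field"
  assumes indep: "alg_independent I x" and j: "j \<in> {1..r}" and k: "k \<in> {1..r}"
    and cluster: "\<And>j. j \<in> {1..r} \<Longrightarrow> \<exists>q>0. specializes I x v (cluster S j) q"
    and frozen: "\<And>j. j \<in> {1..l} \<Longrightarrow> \<exists>q>0. specializes I x v (frozen S j) q"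
  shows "\<exists>q>0. specializes I x v (cluster (mutate r l k S) j) q"
proof (cases "j = k")
  case False
  then show ?thesis
    using cluster[OF j] by (simp add: mutate_def)
next
  case True
  obtain g where g: "\<And>j. j \<in> {1..r} \<Longrightarrow> 0 < g j \<and> specializes I x v (cluster S j) (g j)"
    using cluster by metis
  obtain h where h: "\<And>j. j \<in> {1..l} \<Longrightarrow> 0 < h j \<and> specializes I x v (frozen S j) (h j)"
    using frozen by metis
  \<comment> \<open>The values of the two exchange monomials, for \<open>s = 1\<close> and
    \<open>s = -1\<close>.\<close>
  let ?q = "\<lambda>s. monomial_of r g (\<lambda>i. pos_part (s * B_col S k i)) *
      monomial_of l h (\<lambda>i. pos_part (s * P_col r S k i))"
  have "specializes I x v (cluster (mutate r l k S) j) ((?q 1 + ?q (-1)) / g k)"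
    using g[OF k] g h True
    by (auto simp: mutate_def intro!: specializes_divide[OF indep] specializes_add
        specializes_mult specializes_monomial_of)
  moreover have "(?q 1 + ?q (-1)) / g k > 0"
    using g h k by (intro divide_pos_pos add_pos_pos mult_pos_pos monomial_of_pos) auto
  ultimately show ?thesis
    by blast
qed

lemma seeds_specialize_pos:
  fixes v :: "nat \<Rightarrow> 'b::linordered_field"
  assumes "alg_independent I x"
    and "\<And>j. j \<in> {1..r} \<Longrightarrow> \<exists>q>0. specializes I x v (cluster S0 j) q"
    and "\<And>j. j \<in> {1..l} \<Longrightarrow> \<exists>q>0. specializes I x v (frozen S0 j) q"
    and "S \<in> seeds r l S0" and "j \<in> {1..r}"
  shows "\<exists>q>0. specializes I x v (cluster S j) q"
  using assms(4,5)
proof (induction arbitrary: j rule: seeds.induct)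
  case initial
  then show ?case using assms(2) by blast
next
  case (mutation S k)
  then show ?case
    by (intro cluster_mutate_specializes_pos[OF assms(1)])
       (use assms(3) frozen_seeds[OF mutation.hyps(1)] in auto)
qed

section \<open>Exchange relations and values along the acyclic belt\<close>

lemma acyclic_exchange_numerator:
  assumes "symmetrizable_gcm r A" "k \<in> {1..r}"
    and "\<forall>i\<in>{1..r}. \<forall>j\<in>{1..r}. exmat S i j = belt_matrix A k i j"
  shows "cluster (mutate r l k S) k =
    (monomial_of l (frozen S) (\<lambda>i. pos_part (P_col r S k i)) +
     monomial_of l (frozen S) (\<lambda>i. pos_part (- P_col r S k i)) *
       (\<Prod>j\<in>{k + 1..r}. cluster S j ^ nat (- A j k)) *
       (\<Prod>j\<in>{1..<k}. cluster S j ^ nat (- A j k))) / cluster S k"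
proof -
  have col: "B_col S k j = (if j = k then 0 else A j k)" if "j \<in> {1..r}" for j
    using assms(2,3) that by (auto simp: B_col_def belt_matrix_def B_of_def)
  have neg: "A j k \<le> 0" if "j \<in> {1..r}" "j \<noteq> k" for j
    using assms(1,2) that by (simp add: symmetrizable_gcm_def)
  \<comment> \<open>Since \<open>k\<close> comes first in the order, its column has no positive
    entry: all cluster variables gather in the other monomial.\<close>
  have 1: "monomial_of r (cluster S) (\<lambda>i. pos_part (B_col S k i)) = 1"
    unfolding monomial_of_def
    by (rule prod.neutral) (auto simp: col pos_part_def neg max_def)
  have "monomial_of r (cluster S) (\<lambda>i. pos_part (- B_col S k i)) =
      (\<Prod>j\<in>{1..r} - {k}. cluster S j ^ nat (- A j k))"
    unfolding monomial_of_def
    by (rule prod.mono_neutral_cong_right) (auto simp: col pos_part_def neg max_def)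
  also have "{1..r} - {k} = {k + 1..r} \<union> {1..<k}"
    using assms(2) by auto
  also have "(\<Prod>j\<in>{k + 1..r} \<union> {1..<k}. cluster S j ^ nat (- A j k)) =
      (\<Prod>j\<in>{k + 1..r}. cluster S j ^ nat (- A j k)) *
      (\<Prod>j\<in>{1..<k}. cluster S j ^ nat (- A j k))"
    by (rule prod.union_disjoint) auto
  finally show ?thesis
    using 1 by (simp add: mutate_def mult_ac)
qed

text \<open>The exchange numerator involves only cluster variables with index other than
  \<open>k\<close>, which have the same values before and after mutation. So its value
  \<open>g k * g' k\<close> is known from either side, and dividing by one factor gives the
  other.\<close>

lemma belt_step:
  fixes v :: "nat \<Rightarrow> 'b::field_char_0"
  assumes indep: "alg_independent I x" and gcm: "symmetrizable_gcm r A" and k: "k \<in> {1..r}"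
    and mat: "\<forall>i\<in>{1..r}. \<forall>j\<in>{1..r}. exmat S i j = belt_matrix A k i j"
    and frozen: "\<And>j. j \<in> {1..l} \<Longrightarrow> specializes I x v (frozen S j) (h j)"
    and g': "\<And>j. j \<noteq> k \<Longrightarrow> g' j = g j" and nz: "g k \<noteq> 0" "g' k \<noteq> 0"
    and rel: "g k * g' k =
      monomial_of l h (\<lambda>i. pos_part (P_col r S k i)) +
      monomial_of l h (\<lambda>i. pos_part (- P_col r S k i)) *
        (\<Prod>j\<in>{k + 1..r}. g j ^ nat (- A j k)) * (\<Prod>j\<in>{1..<k}. g' j ^ nat (- A j k))"
  shows "(\<forall>j\<in>{1..r}. specializes I x v (cluster S j) (g j)) \<longleftrightarrow>
    (\<forall>j\<in>{1..r}. specializes I x v (cluster (mutate r l k S) j) (g' j))" (is "?L \<longleftrightarrow> ?R")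
proof -
  define N where "N = monomial_of l (frozen S) (\<lambda>i. pos_part (P_col r S k i)) +
     monomial_of l (frozen S) (\<lambda>i. pos_part (- P_col r S k i)) *
       (\<Prod>j\<in>{k + 1..r}. cluster S j ^ nat (- A j k)) *
       (\<Prod>j\<in>{1..<k}. cluster S j ^ nat (- A j k))"
  have new: "cluster (mutate r l k S) k = N / cluster S k"
    unfolding N_def by (rule acyclic_exchange_numerator[OF gcm k mat])
  have old: "cluster (mutate r l k S) j = cluster S j" if "j \<noteq> k" for j
    using that by (simp add: mutate_def)
  have N: "specializes I x v N (g k * g' k)"
    if "\<And>j. j \<in> {1..r} \<Longrightarrow> j \<noteq> k \<Longrightarrow> specializes I x v (cluster S j) (g j)"
    unfolding N_def rel
    by (intro specializes_add specializes_mult specializes_monomial_of specializes_prod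
        specializes_power) (use that frozen k g' in auto)
  show ?thesis
  proof
    assume ?L
    then have "specializes I x v (N / cluster S k) (g k * g' k / g k)"
      using k nz by (intro specializes_divide[OF indep] N) auto
    then show ?R
      using \<open>?L\<close> new old g' nz by (metis nonzero_mult_div_cancel_left)
  next
    assume ?R
    then have off: "\<And>j. j \<in> {1..r} \<Longrightarrow> j \<noteq> k \<Longrightarrow> specializes I x v (cluster S j) (g j)"
      using old g' by metis
    have R: "specializes I x v (N / cluster S k) (g' k)"
      using \<open>?R\<close> k new by metis
    \<comment> \<open>As division by zero yields 0, this excludes both \<open>N = 0\<close> and
      \<open>cluster S k = 0\<close>; hence dividing \<open>N\<close> by this quotient recovers
      \<open>cluster S k\<close>.\<close>
    then have "N / cluster S k \<noteq> 0"
      using specializes_zero_imp[OF indep] nz(2) by metis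
    moreover have "specializes I x v (N / (N / cluster S k)) (g k * g' k / g' k)"
      using nz by (intro specializes_divide[OF indep] N off R)
    ultimately have "specializes I x v (cluster S k) (g k)"
      using nz by simp
    then show ?L
      using off by metis
  qed
qed

text \<open>
  For negative \<open>m\<close>, membership of \<open>t(i,m)\<close> in the seeds needs that mutation is an involution there,
  which rests on the nonvanishing of the values; hence the joint induction.
\<close>

lemma belt_specializes:
  fixes v :: "nat \<Rightarrow> 'b::field_char_0"
  assumes indep: "alg_independent I x" and gcm: "symmetrizable_gcm r A"
    and S0: "exmat S0 = stack r (B_of A) P"
    and belt: "acyclic_belt r l S0 t"
    and pattern: "frieze_pattern r l A (belt_coeff r t) f fp"
    and cluster: "\<And>j. j \<in> {1..r} \<Longrightarrow> specializes I x v (cluster S0 j) (of_int (f j 0))"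
    and frozen: "\<And>j. j \<in> {1..l} \<Longrightarrow> specializes I x v (frozen S0 j) (of_int (fp j))"
    and i: "i \<in> {1..r}"
  shows "t i m \<in> seeds r l S0" and "specializes I x v (belt_var t i m) (of_int (f i m))"
proof -
  \<comment> \<open>The extra index \<open>r + 1\<close> names the seed at \<open>t(1,m+1)\<close>,
    so the last mutation of a round is also a step from \<open>k\<close> to
    \<open>Suc k\<close>.\<close>
  define s where "s k m = (if k \<le> r then t k m else t 1 (m + 1))" for k m
  have s_step: "s (Suc k) m = mutate r l k (t k m)" if "k \<in> {1..r}" for k m
    using belt that unfolding s_def acyclic_belt_def by (cases "k = r") auto
  \<comment> \<open>The expected values of the cluster at \<open>t(k,m)\<close>: the variables with
    index below \<open>k\<close> have already been mutated in round \<open>m\<close>.\<close>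
  define g where "g k m j = (if j < k then f j (m + 1) else f j m)" for k m j
  define inv where "inv k S gv \<longleftrightarrow> S \<in> seeds r l S0 \<and> frozen S = frozen S0 \<and>
      (\<forall>i\<in>{1..r}. \<forall>j\<in>{1..r}. exmat S i j = belt_matrix A k i j) \<and>
      (\<forall>j\<in>{1..r}. specializes I x v (cluster S j) (of_int (gv j :: int)))" for k S gv
  have f_pos: "f j m > 0" if "j \<in> {1..r}" for j m
    using pattern that by (simp add: frieze_pattern_def)
  have inv_step: "inv k (t k m) (g k m) \<longleftrightarrow> inv (Suc k) (s (Suc k) m) (g (Suc k) m)"
    if k: "k \<in> {1..r}" for k m
  proof -
    have "(\<forall>j\<in>{1..r}. specializes I x v (cluster (t k m) j) (of_int (g k m j))) \<longleftrightarrow>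
        (\<forall>j\<in>{1..r}. specializes I x v (cluster (mutate r l k (t k m)) j) (of_int (g (Suc k) m j)))"
      if fr: "frozen (t k m) = frozen S0"
        and mat: "\<forall>i\<in>{1..r}. \<forall>j\<in>{1..r}. exmat (t k m) i j = belt_matrix A k i j"
    proof (rule belt_step[OF indep gcm k mat, where h = "\<lambda>j. of_int (fp j)"])
      have "f k m * f k (m + 1) =
          monomial_of l fp (\<lambda>j. pos_part (P_col r (t k m) k j)) +
          monomial_of l fp (\<lambda>j. pos_part (- P_col r (t k m) k j)) *
            (\<Prod>j\<in>{k + 1..r}. f j m ^ nat (- A j k)) *
            (\<Prod>j\<in>{1..<k}. f j (m + 1) ^ nat (- A j k))"
        using pattern k by (simp add: frieze_pattern_def belt_coeff_def)
      then have "(of_int (g k m k * g (Suc k) m k) :: 'b) =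
          of_int (monomial_of l fp (\<lambda>j. pos_part (P_col r (t k m) k j)) +
          monomial_of l fp (\<lambda>j. pos_part (- P_col r (t k m) k j)) *
            (\<Prod>j\<in>{k + 1..r}. g k m j ^ nat (- A j k)) *
            (\<Prod>j\<in>{1..<k}. g (Suc k) m j ^ nat (- A j k)))"
        by (simp add: g_def)
      then show "(of_int (g k m k) * of_int (g (Suc k) m k) :: 'b) =
          monomial_of l (\<lambda>j. of_int (fp j)) (\<lambda>j. pos_part (P_col r (t k m) k j)) +
          monomial_of l (\<lambda>j. of_int (fp j)) (\<lambda>j. pos_part (- P_col r (t k m) k j)) *
            (\<Prod>j\<in>{k + 1..r}. of_int (g k m j) ^ nat (- A j k)) *
            (\<Prod>j\<in>{1..<k}. of_int (g (Suc k) m j) ^ nat (- A j k))"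
        by (simp add: of_int_monomial_of)
    qed (use fr frozen f_pos[OF k, of m] f_pos[OF k, of "m + 1"] in \<open>auto simp: g_def\<close>)
    note vals = this
    have "t k m \<in> seeds r l S0"
      if new: "mutate r l k (t k m) \<in> seeds r l S0"
        and mat: "\<forall>i\<in>{1..r}. \<forall>j\<in>{1..r}. exmat (t k m) i j = belt_matrix A k i j"
        and val: "\<forall>j\<in>{1..r}. specializes I x v (cluster (t k m) j) (of_int (g k m j))"
          "\<forall>j\<in>{1..r}. specializes I x v (cluster (mutate r l k (t k m)) j) (of_int (g (Suc k) m j))"
    proof -
      \<comment> \<open>Positivity of the frieze pattern makes the old and the new variable nonzero,
        so the same mutation leads back from the new seed to \<open>t k m\<close>.\<close>
      have "(of_int (g k m k) :: 'b) \<noteq> 0" "(of_int (g (Suc k) m k) :: 'b) \<noteq> 0"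
        using f_pos[OF k, of m] f_pos[OF k, of "m + 1"] by (simp_all add: g_def)
      then have "cluster (t k m) k \<noteq> 0" "cluster (mutate r l k (t k m)) k \<noteq> 0"
        using val k specializes_zero_imp[OF indep] by metis+
      then have "mutate r l k (mutate r l k (t k m)) = t k m"
        using mat k by (intro mutate_involutive) (auto simp: belt_matrix_def B_of_def)
      then show ?thesis
        using seeds.mutation[OF new k] by simp
    qed
    then show ?thesis
      using belt_matrix_step[OF gcm k, of "exmat (t k m)"] vals seeds.mutation[OF _ k]
      unfolding inv_def s_step[OF k] frozen_mutate exmat_mutate by blast
  qed
  have row: "inv 1 (t 1 m) (g 1 m) \<longleftrightarrow> inv k (s k m) (g k m)" if "k \<in> {1..Suc r}" for k m
  proof -
    from that have "1 \<le> k" by simp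
    then show ?thesis
      using that
    proof (induction k rule: dec_induct)
      \<comment> \<open>The index \<open>i\<close> guarantees that \<open>r\<close> is at least 1,
        so \<open>s 1 m\<close> is \<open>t 1 m\<close>.\<close>
      case base
      then show ?case using i by (simp add: s_def)
    next
      case (step n)
      then show ?case
        using inv_step[of n m] by (simp add: s_def)
    qed
  qed
  \<comment> \<open>After a full round every index up to \<open>r\<close> has changed sides, so
    \<open>belt_matrix\<close> takes the same entries as for \<open>k = 1\<close>, and all values
    have moved on to \<open>m + 1\<close>.\<close>
  have wrap: "inv (Suc r) (s (Suc r) m) (g (Suc r) m) \<longleftrightarrow> inv 1 (t 1 (m + 1)) (g 1 (m + 1))" for m
    unfolding inv_def by (simp add: s_def g_def belt_matrix_def less_Suc_eq_le)
  have "inv 1 (t 1 m) (g 1 m)"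
  proof (induction m rule: int_induct[where k = 0])
    case base
    have "t 1 0 = S0"
      using belt by (simp add: acyclic_belt_def)
    then show ?case
      using cluster by (auto simp: inv_def g_def S0 stack_def belt_matrix_def seeds.initial)
  next
    case (step1 m)
    then show ?case
      using row[of "Suc r" m] wrap[of m] by simp
  next
    case (step2 m)
    then show ?case
      using row[of "Suc r" "m - 1"] wrap[of "m - 1"] by simp
  qed
  then have "inv i (t i m) (g i m)"
    using row[of i m] i by (simp add: s_def)
  then show "t i m \<in> seeds r l S0" "specializes I x v (belt_var t i m) (of_int (f i m))"
    unfolding inv_def belt_var_def using i by (auto simp: g_def dest: bspec[of _ _ i])
qed

section \<open>Generated subrings\<close>

lemma is_subring_hull: "is_subring (is_subring hull X)"
  by (rule hull_in) (auto simp: is_subring_def)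

lemma is_subring_zero: "is_subring R \<Longrightarrow> 0 \<in> R"
  unfolding is_subring_def by (metis diff_self)

lemma is_subring_add:
  assumes "is_subring R" "a \<in> R" "b \<in> R"
  shows "a + b \<in> R"
proof -
  have "a - (0 - b) \<in> R"
    using assms is_subring_zero[OF assms(1)] unfolding is_subring_def by blast
  then show ?thesis by simp
qed

lemma subring_generated_minimal:
  "X \<subseteq> R \<Longrightarrow> is_subring R \<Longrightarrow> subring_generated X \<subseteq> R"
  unfolding subring_generated_def by (rule hull_minimal)

text \<open>The elements on which both maps agree form a subring containing
  \<open>X\<close>.\<close>

lemma ring_homs_eq_on_generated:
  fixes h h' :: "'a::comm_ring_1 \<Rightarrow> 'b::ring_1"
  assumes hom: "\<And>g. g \<in> {h, h'} \<Longrightarrow> g 1 = 1 \<and> (\<forall>a\<in>subring_generated X. \<forall>b\<in>subring_generated X.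
        g (a + b) = g a + g b \<and> g (a * b) = g a * g b)"
    and "\<And>a. a \<in> X \<Longrightarrow> h a = h' a" "a \<in> subring_generated X"
  shows "h a = h' a"
proof -
  let ?R = "subring_generated X"
  have R: "is_subring ?R"
    unfolding subring_generated_def by (rule is_subring_hull)
  \<comment> \<open>The maps are assumed to preserve sums, while \<open>is_subring\<close> is
    phrased with differences.\<close>
  have diff: "g (a - b) = g a - g b" if "g \<in> {h, h'}" "a \<in> ?R" "b \<in> ?R" for g a b
  proof -
    have "a - b \<in> ?R"
      using R that unfolding is_subring_def by blast
    then have "g (a - b + b) = g (a - b) + g b"
      using hom that by blast
    then show ?thesis by simp
  qed
  have "is_subring {a \<in> ?R. h a = h' a}"
    unfolding is_subring_def
  proof (intro conjI ballI)
    show "1 \<in> {a \<in> ?R. h a = h' a}"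
      using R hom[of h] hom[of h'] by (simp add: is_subring_def)
  next
    fix a b assume "a \<in> {a \<in> ?R. h a = h' a}" "b \<in> {a \<in> ?R. h a = h' a}"
    then show "a - b \<in> {a \<in> ?R. h a = h' a}" "a * b \<in> {a \<in> ?R. h a = h' a}"
      using R hom[of h] hom[of h'] diff[of h a b] diff[of h' a b]
      by (simp_all add: is_subring_def)
  qed
  moreover have "X \<subseteq> {a \<in> ?R. h a = h' a}"
    using assms(2) hull_subset[of X is_subring] by (auto simp: subring_generated_def)
  ultimately show ?thesis
    using subring_generated_minimal assms(3) by blast
qed

section \<open>Friezes from frieze patterns\<close>

theorem proposition5p11:
  fixes r l :: nat
    and A P :: "nat \<Rightarrow> nat \<Rightarrow> int"
    and S0 :: "'k::field_char_0 seed"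
    and t :: "nat \<Rightarrow> int \<Rightarrow> 'k seed"
    and Z :: "'k set"
    and f :: "nat \<Rightarrow> int \<Rightarrow> int"
    and fp :: "nat \<Rightarrow> int"
  assumes "symmetrizable_gcm r A"
    and "is_seed r l S0"
    and "exmat S0 = stack r (B_of A) P"
    and "acyclic_belt r l S0 t"
    and "Z \<subseteq> {belt_var t i m | i m. i \<in> {1..r}}"
    and "cluster_algebra r l S0 =
           subring_generated (subring_generated (frozen_variables l S0) \<union> Z)"
    and "frieze_pattern r l A (belt_coeff r t) f fp"
  shows "\<exists>!h. is_frieze r l S0 h \<and>
           (\<forall>i\<in>{1..r}. \<forall>m. f i m = h (belt_var t i m)) \<and>
           (\<forall>j\<in>{1..l}. fp j = h (frozen S0 j))"
proof -
  note gcm = assms(1) and S0 = assms(3) and belt = assms(4) and pattern = assms(7)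
  define I where "I = {1..r + l}"
  define x where "x = (\<lambda>i. if i \<le> r then cluster S0 i else frozen S0 (i - r))"
  \<comment> \<open>The values are taken in the rationals because division is needed; integrality on
    the cluster algebra comes from its generators.\<close>
  define v :: "nat \<Rightarrow> rat"
    where "v = (\<lambda>i. of_int (if i \<le> r then f i 0 else fp (i - r)))"
  let ?R = "cluster_algebra r l S0"
  let ?E = "extended_cluster_variables r l S0"
  have indep: "alg_independent I x"
    using assms(2) by (simp add: is_seed_def freely_generates_def I_def x_def)
  have cluster: "specializes I x v (cluster S0 j) (of_int (f j 0))" if "j \<in> {1..r}" for j
    using specializes_var[of j I x v] that by (simp add: I_def x_def v_def)
  have frozen: "specializes I x v (frozen S0 j) (of_int (fp j))" if "j \<in> {1..l}" for j
    using specializes_var[of "r + j" I x v] that by (simp add: I_def x_def v_def)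
  note belt_seed = belt_specializes(1)[OF indep gcm S0 belt pattern cluster frozen]
  note belt_val = belt_specializes(2)[OF indep gcm S0 belt pattern cluster frozen]
  \<comment> \<open>A frieze must be positive on the extended cluster variables of all seeds,
    including those off the belt.\<close>
  have pos: "\<exists>q>0. specializes I x v a q" if "a \<in> ?E" for a
  proof -
    have 1: "\<exists>q>0. specializes I x v (cluster S0 j) q" if "j \<in> {1..r}" for j
      using pattern cluster[OF that] that of_int_pos unfolding frieze_pattern_def by blast
    have 2: "\<exists>q>0. specializes I x v (frozen S0 j) q" if "j \<in> {1..l}" for j
      using pattern frozen[OF that] that of_int_pos unfolding frieze_pattern_def by blast
    have "\<exists>q>0. specializes I x v (cluster S j) q" if "S \<in> seeds r l S0" "j \<in> {1..r}" for S j
      using 1 2 that by (rule seeds_specialize_pos[OF indep])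
    then show ?thesis
      using that 2
      by (auto simp: extended_cluster_variables_def cluster_variables_def frozen_variables_def)
  qed
  have E: "?E \<subseteq> ?R"
    unfolding cluster_algebra_def subring_generated_def by (rule hull_subset)
  have R: "is_subring ?R"
    unfolding cluster_algebra_def subring_generated_def by (rule is_subring_hull)
  have R_gen: "?R = subring_generated (frozen_variables l S0 \<union> Z)"
    using assms(6) hull_Un_left[of is_subring] unfolding subring_generated_def by blast
  have belt_R: "belt_var t i m \<in> ?R" if "i \<in> {1..r}" for i m
    using E belt_seed[OF _ _ that, of m] that
    unfolding extended_cluster_variables_def cluster_variables_def belt_var_def by blast
  have frozen_R: "frozen S0 j \<in> ?R" if "j \<in> {1..l}" for j
    using E that by (auto simp: extended_cluster_variables_def frozen_variables_def)

  have integral: "\<exists>n::int. specializes I x v a (of_int n)" if "a \<in> ?R" for a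
  proof -
    have "frozen_variables l S0 \<subseteq> {a. \<exists>n::int. specializes I x v a (of_int n)}"
      using frozen unfolding frozen_variables_def by blast
    moreover have "Z \<subseteq> {a. \<exists>n::int. specializes I x v a (of_int n)}"
      using assms(5) belt_val by fast
    moreover have "is_subring {a. \<exists>n::int. specializes I x v a (of_int n)}"
      unfolding is_subring_def
    proof (intro conjI ballI)
      show "1 \<in> {a. \<exists>n::int. specializes I x v a (of_int n)}"
        using specializes_one[of I x v] of_int_1 by (metis mem_Collect_eq)
    next
      fix a b
      assume "a \<in> {a. \<exists>n::int. specializes I x v a (of_int n)}"
        and "b \<in> {a. \<exists>n::int. specializes I x v a (of_int n)}"
      then obtain m n :: int where "specializes I x v a (of_int m)" "specializes I x v b (of_int n)"
        by blast
      then have "specializes I x v (a - b) (of_int (m - n))"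
        and "specializes I x v (a * b) (of_int (m * n))"
        by (simp_all add: specializes_diff specializes_mult)
      then show "a - b \<in> {a. \<exists>n::int. specializes I x v a (of_int n)}"
        and "a * b \<in> {a. \<exists>n::int. specializes I x v a (of_int n)}"
        by blast+
    qed
    ultimately show ?thesis
      using subring_generated_minimal[of "frozen_variables l S0 \<union> Z"] that
      unfolding R_gen by blast
  qed
  \<comment> \<open>Existence of the integer is \<open>integral\<close>, uniqueness is
    \<open>specializes_unique\<close>; \<open>restrict\<close> makes \<open>h\<close>
    extensional.\<close>
  define h where "h = restrict (\<lambda>a. THE n. specializes I x v a (of_int n)) ?R"
  have h_eq: "h a = n" if "a \<in> ?R" "specializes I x v a (of_int n)" for a n
    unfolding h_def restrict_apply'[OF that(1)]
  proof (rule the_equality)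
    show "specializes I x v a (of_int n)"
      by (rule that(2))
  next
    fix n' :: int assume "specializes I x v a (of_int n')"
    then have "of_int n' = (of_int n :: rat)"
      using that(2) by (rule specializes_unique[OF indep])
    then show "n' = n" by simp
  qed
  have h_val: "specializes I x v a (of_int (h a))" if "a \<in> ?R" for a
    using integral[OF that] h_eq[OF that] by blast
  have h_hom: "h (a + b) = h a + h b" "h (a * b) = h a * h b" if "a \<in> ?R" "b \<in> ?R" for a b
  proof -
    have "a + b \<in> ?R" "a * b \<in> ?R"
      using is_subring_add[OF R that] R that unfolding is_subring_def by blast+
    then show "h (a + b) = h a + h b" "h (a * b) = h a * h b"
      using specializes_add[OF h_val h_val, OF that] specializes_mult[OF h_val h_val, OF that]
      by (simp_all add: h_eq)
  qed
  have h_belt: "h (belt_var t i m) = f i m" if "i \<in> {1..r}" for i m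
    using h_eq[OF belt_R belt_val] that by blast
  have h_frozen: "h (frozen S0 j) = fp j" if "j \<in> {1..l}" for j
    using h_eq[OF frozen_R frozen] that by blast
  have "h 1 = 1"
    using R by (intro h_eq) (simp_all add: is_subring_def specializes_one)
  \<comment> \<open>The positive rational value from \<open>pos\<close> must coincide with the
    integer \<open>h a\<close> by uniqueness of values.\<close>
  moreover have "h a > 0" if "a \<in> ?E" for a
  proof -
    have "a \<in> ?R"
      using E that by blast
    then show ?thesis
      using pos[OF that] specializes_unique[OF indep h_val[OF \<open>a \<in> ?R\<close>]]
      by (metis of_int_0_less_iff)
  qed
  ultimately have frieze: "is_frieze r l S0 h"
    using h_hom by (simp add: is_frieze_def h_def)
  show ?thesis
  proof (rule ex1I[of _ h])
    show "is_frieze r l S0 h \<and> (\<forall>i\<in>{1..r}. \<forall>m. f i m = h (belt_var t i m)) \<and>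
        (\<forall>j\<in>{1..l}. fp j = h (frozen S0 j))"
      using frieze h_belt h_frozen by simp
  next
    fix h' assume h': "is_frieze r l S0 h' \<and> (\<forall>i\<in>{1..r}. \<forall>m. f i m = h' (belt_var t i m)) \<and>
        (\<forall>j\<in>{1..l}. fp j = h' (frozen S0 j))"
    have "h' a = h a" if "a \<in> ?R" for a
    proof (rule ring_homs_eq_on_generated[where h = h' and h' = h])
      show "a \<in> subring_generated (frozen_variables l S0 \<union> Z)"
        using that R_gen by simp
    next
      fix b assume "b \<in> frozen_variables l S0 \<union> Z"
      then show "h' b = h b"
      proof
        assume "b \<in> frozen_variables l S0"
        then show ?thesis
          using h' h_frozen by (auto simp: frozen_variables_def)
      next
        assume "b \<in> Z"
        then obtain i m where "b = belt_var t i m" "i \<in> {1..r}"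
          using assms(5) by blast
        then show ?thesis
          using h' h_belt by auto
      qed
    next
      fix g assume "g \<in> {h', h}"
      then have "is_frieze r l S0 g"
        using frieze h' by blast
      then show "g 1 = 1 \<and> (\<forall>a\<in>subring_generated (frozen_variables l S0 \<union> Z).
          \<forall>b\<in>subring_generated (frozen_variables l S0 \<union> Z).
            g (a + b) = g a + g b \<and> g (a * b) = g a * g b)"
        unfolding is_frieze_def R_gen by blast
    qed
    moreover have "h' \<in> extensional ?R" "h \<in> extensional ?R"
      using h' frieze by (simp_all add: is_frieze_def)
    ultimately show "h' = h"
      by (intro extensionalityI) simp_all
  qed
qed

end
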